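(* Let $A \in \mathbb{DC}^{n \times n}$. There exist a unitary matrix $U\in \mathbb{DC}^{n \times n}$ and a complex symmetric matrix $S\in \mathbb{DC}^{n \times n}$ such that $A=SU$. Furthermore, both a left and a right dual symmetric unitary polar decomposition (DSUPD) exist for every matrix $A\in\mathbb{DC}^{n\times n}$, and such a decomposition is always non-unique.
   Context: Let $\epsilon$ be an infinitesimal unit: $\epsilon\neq 0$, $\epsilon^2=0$, commuting with all complex numbers. $\mathbb{DC}=\{a_s+a_d\epsilon : a_s,a_d\in\mathbb{C}\}$ is the set of dual complex numbers, with $(a_s+a_d\epsilon)+(b_s+b_d\epsilon)=(a_s+b_s)+(a_d+b_d)\epsilon$ and $(a_s+a_d\epsilon)(b_s+b_d\epsilon)=a_sb_s+(a_sb_d+a_db_s)\epsilon$. $\mathbb{DC}^{n\times n}$ is the set of matrices $A=A_s+A_d\epsilon$ with $A_s,A_d\in\mathbb{C}^{n\times n}$; its conjugate transpose is $A^*=A_s^*+A_d^*\epsilon$ and its transpose is $A^{T}=A_s^{T}+A_d^{T}\epsilon$. A matrix $U\in\mathbb{DC}^{n\times n}$ is unitary if $U^*U=UU^*=I_n$. A matrix $S\in\mathbb{DC}^{n\times n}$ is (dual) complex symmetric if $S^{T}=S$. A left DSUPD of $A$ is a factorization $A=SU$ with $S\in\mathbb{DC}^{n\times n}$ complex symmetric and $U\in\mathbb{DC}^{n\times n}$ unitary. A right DSUPD of $A$ is a factorization $A=VR$ with $V\in\mathbb{DC}^{n\times n}$ unitary and $R\in\mathbb{DC}^{n\times n}$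 complex symmetric. *)

theory Defs
  imports "HOL-Analysis.Analysis"
begin

datatype dual_complex = Dual (std_part: complex) (dual_part: complex)

instantiation dual_complex :: comm_ring_1
begin

definition "0 = Dual 0 0"
definition "1 = Dual 1 0"
definition "x + y = Dual (std_part x + std_part y) (dual_part x + dual_part y)"
definition "- x = Dual (- std_part x) (- dual_part x)"
definition "x - y = Dual (std_part x - std_part y) (dual_part x - dual_part y)"
definition "x * y = Dual (std_part x * std_part y)
                         (std_part x * dual_part y + dual_part x * std_part y)"

instance
  by standard
    (simp_all add: zero_dual_complex_def one_dual_complex_def plus_dual_complex_def
      uminus_dual_complex_def minus_dual_complex_def times_dual_complex_def algebra_simps)

end

definition dual_eps :: dual_complex where
  "dual_eps = Dual 0 1"

lemma dual_eps_nonzero: "dual_eps \<noteq> 0"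
  by (simp add: dual_eps_def zero_dual_complex_def)

lemma dual_eps_square: "dual_eps ^ 2 = 0"
  by (simp add: dual_eps_def zero_dual_complex_def times_dual_complex_def power2_eq_square)

lemma Dual_eq_eps: "Dual a b = Dual a 0 + Dual b 0 * dual_eps"
  by (simp add: dual_eps_def plus_dual_complex_def times_dual_complex_def)

text \<open>
  Conjugation fixes the infinitesimal unit, so the entrywise conjugate transpose below is
  \<open>A\<^sub>s\<^sup>* + A\<^sub>d\<^sup>* \<epsilon>\<close>, where \<open>A = A\<^sub>s + A\<^sub>d \<epsilon>\<close>.
\<close>

definition dual_cnj :: "dual_complex \<Rightarrow> dual_complex" where
  "dual_cnj x = Dual (cnj (std_part x)) (cnj (dual_part x))"

definition conj_transpose :: "dual_complex^'n^'m \<Rightarrow> dual_complex^'m^'n" where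
  "conj_transpose A = (\<chi> i j. dual_cnj (A $ j $ i))"

definition dual_unitary :: "dual_complex^'n^'n \<Rightarrow> bool" where
  "dual_unitary U \<longleftrightarrow> conj_transpose U ** U = mat 1 \<and> U ** conj_transpose U = mat 1"

definition dual_symmetric :: "dual_complex^'n^'n \<Rightarrow> bool" where
  "dual_symmetric S \<longleftrightarrow> transpose S = S"

definition left_DSUPD ::
    "dual_complex^'n^'n \<Rightarrow> dual_complex^'n^'n \<Rightarrow> dual_complex^'n^'n \<Rightarrow> bool" where
  "left_DSUPD A S U \<longleftrightarrow> dual_symmetric S \<and> dual_unitary U \<and> A = S ** U"

definition right_DSUPD ::
    "dual_complex^'n^'n \<Rightarrow> dual_complex^'n^'n \<Rightarrow> dual_complex^'n^'n \<Rightarrow> bool" where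
  "right_DSUPD A V R \<longleftrightarrow> dual_unitary V \<and> dual_symmetric R \<and> A = V ** R"

end

theory Submission
  imports Defs
begin

text \<open>
  If \<open>W\<^sup>* A V = D\<close> with \<open>W\<close>, \<open>V\<close> unitary and \<open>D\<close> symmetric, then
  \<open>A = (W D W\<^sup>T) (W\<^sup>T\<^sup>* V\<^sup>*)\<close> is a left decomposition. Transposing a left decomposition of
  \<open>A\<^sup>T\<close> gives a right one of \<open>A\<close>, and changing the sign of both factors gives a second
  decomposition, because a unitary \<open>U\<close> of positive size differs from \<open>- U\<close>. So everything rests
  on a singular value decomposition over the dual complex numbers.

  For \<open>A = X + E \<epsilon>\<close> it is not enough to start from an arbitrary decomposition
  \<open>W\<^sup>* X V = \<Sigma>\<close> of the standard part. The remaining freedom is to replace \<open>W\<close>, \<open>V\<close> by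
  \<open>W (I + P \<epsilon>)\<close>, \<open>V (I + Q \<epsilon>)\<close> with skew-Hermitian \<open>P\<close>, \<open>Q\<close>, which adds \<open>\<Sigma> Q - P \<Sigma>\<close> to
  the dual part \<open>B = W\<^sup>* E V\<close>. The entries \<open>(i, j)\<close> and \<open>(j, i)\<close> of this term take arbitrary
  values when \<open>\<sigma>\<^sub>i \<noteq> \<sigma>\<^sub>j\<close>, but form only a skew-Hermitian pair when \<open>\<sigma>\<^sub>i = \<sigma>\<^sub>j > 0\<close>, and vanish when
  \<open>\<sigma>\<^sub>i = \<sigma>\<^sub>j = 0\<close>. Hence within a block of equal singular values, the frames must also diagonalize
  the Hermitian part of \<open>B\<close> (for a positive value) or the whole of \<open>B\<close> (for the value zero).

  Both the decomposition of \<open>X\<close> and this adaptation to \<open>E\<close> come from one variational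
  principle. Fix distinct positive weights \<open>d\<close> and maximize \<open>\<Sum> d\<^sub>k Re (W\<^sup>* X V)\<^sub>k\<^sub>k\<close> over the
  compact set of pairs of unitary matrices: stationarity under rotations of each coordinate plane, on
  either side, makes \<open>W\<^sup>* X V\<close> diagonal (\<open>two_sided_maximal\<close>). Then maximize the same functional
  of \<open>E\<close> over the pairs that satisfy \<open>W\<^sup>* X V = \<Sigma>\<close>. In a plane with \<open>\<sigma>\<^sub>i = \<sigma>\<^sub>j\<close>, a simultaneous
  rotation of both frames stays in this set, and stationarity is exactly the condition required for a
  positive singular value (\<open>conjugation_maximal\<close>); if \<open>\<sigma>\<^sub>i = \<sigma>\<^sub>j = 0\<close>, the frames may be rotated
  independently, and the first argument applies again
  (\<open>adapted_singular_value_decomposition\<close>).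
\<close>

section \<open>Complex unitary matrices\<close>

definition adj :: "complex^'n^'m \<Rightarrow> complex^'m^'n" where
  "adj X = (\<chi> i j. cnj (X $ j $ i))"

definition unitary :: "complex^'n^'n \<Rightarrow> bool" where
  "unitary U \<longleftrightarrow> adj U ** U = mat 1"

definition diag :: "('n \<Rightarrow> complex) \<Rightarrow> complex^'n^'n" where
  "diag s = (\<chi> i j. if i = j then s i else 0)"

lemma adj_nth [simp]: "adj X $ i $ j = cnj (X $ j $ i)"
  by (simp add: adj_def)

lemma diag_nth [simp]: "diag s $ i $ j = (if i = j then s i else 0)"
  by (simp add: diag_def)

lemma adj_adj [simp]: "adj (adj X) = X"
  by (simp add: vec_eq_iff)

lemma adj_mult: "adj (X ** Y) = adj Y ** adj X"
  by (simp add: vec_eq_iff matrix_matrix_mult_def mult.commute)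

lemma adj_add: "adj (X + Y) = adj X + adj Y"
  by (simp add: vec_eq_iff)

lemma adj_diag_of_real [simp]: "adj (diag (\<lambda>k. of_real (s k))) = diag (\<lambda>k. of_real (s k))"
  by (simp add: vec_eq_iff)

lemma diag_right: "(X ** diag s) $ i $ j = X $ i $ j * s j"
  by (simp add: matrix_matrix_mult_def if_distrib [of "\<lambda>x. _ * x"] cong: if_cong)

lemma diag_left: "(diag s ** X) $ i $ j = s i * X $ i $ j"
  by (simp add: matrix_matrix_mult_def if_distrib [of "\<lambda>x. x * _"] cong: if_cong)

lemma matrix_diff_rdistrib:
  fixes X Y :: "complex^'n^'m" and Z :: "complex^'k^'n"
  shows "(X - Y) ** Z = X ** Z - Y ** Z"
  by (simp add: matrix_matrix_mult_def vec_eq_iff left_diff_distrib sum_subtractf)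

lemma unitary_right: "unitary U \<Longrightarrow> U ** adj U = mat 1"
  unfolding unitary_def by (simp add: matrix_left_right_inverse)

lemma unitary_mat_1: "unitary (mat 1)"
proof -
  have "adj (mat 1 :: complex^'n^'n) = mat 1"
    by (simp add: vec_eq_iff mat_def)
  then show ?thesis
    by (simp add: unitary_def)
qed

lemma unitary_mult:
  assumes "unitary U" "unitary V"
  shows "unitary (U ** V)"
proof -
  have "adj (U ** V) ** (U ** V) = adj V ** (adj U ** U) ** V"
    by (simp add: adj_mult matrix_mul_assoc)
  then show ?thesis
    using assms by (simp add: unitary_def)
qed

lemma unitary_diag:
  assumes "\<And>k. cmod (u k) = 1"
  shows "unitary (diag u)"
proof -
  have "cnj (u k) * u k = 1" for k
    using assms [of k] by (metis complex_norm_square mult.commute of_real_1 one_power2)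
  then show ?thesis
    by (simp add: unitary_def vec_eq_iff diag_right mat_def)
qed

lemma continuous_on_matrix_mult:
  fixes f :: "'a::topological_space \<Rightarrow> complex^'n^'m" and g :: "'a \<Rightarrow> complex^'k^'n"
  assumes "continuous_on S f" "continuous_on S g"
  shows "continuous_on S (\<lambda>x. f x ** g x)"
  unfolding matrix_matrix_mult_def using assms by (auto intro!: continuous_intros)

lemma continuous_on_adj:
  fixes f :: "'a::topological_space \<Rightarrow> complex^'n^'m"
  assumes "continuous_on S f"
  shows "continuous_on S (\<lambda>x. adj (f x))"
  unfolding adj_def using assms by (auto intro!: continuous_intros)

text \<open>Each row of a unitary matrix has norm 1, which bounds the whole matrix.\<close>

lemma compact_unitary: "compact {U :: complex^'n^'n. unitary U}"
  unfolding compact_eq_bounded_closed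
proof
  have "norm U \<le> real CARD('n)" if "unitary U" for U :: "complex^'n^'n"
  proof -
    have row: "norm (U $ i) = 1" for i
    proof -
      have "(\<Sum>k\<in>UNIV. U $ i $ k * cnj (U $ i $ k)) = (U ** adj U) $ i $ i"
        by (simp add: matrix_matrix_mult_def)
      also have "\<dots> = 1"
        by (simp add: unitary_right [OF that] mat_def)
      finally have "complex_of_real (\<Sum>k\<in>UNIV. (cmod (U $ i $ k))\<^sup>2) = of_real 1"
        by (simp add: complex_norm_square del: of_real_power)
      then have "(\<Sum>k\<in>UNIV. (cmod (U $ i $ k))\<^sup>2) = 1"
        by (simp only: of_real_eq_iff)
      then show ?thesis
        by (simp add: norm_vec_def L2_set_def)
    qed
    have "norm U \<le> (\<Sum>i\<in>UNIV. norm (U $ i))"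
      unfolding norm_vec_def by (rule L2_set_le_sum) auto
    then show ?thesis
      by (simp add: row)
  qed
  then show "bounded {U :: complex^'n^'n. unitary U}"
    by (auto simp: bounded_iff)
  show "closed {U :: complex^'n^'n. unitary U}"
    unfolding unitary_def
    by (intro closed_Collect_eq continuous_on_matrix_mult continuous_on_adj continuous_intros)
qed

section \<open>Rotations of a coordinate plane\<close>

text \<open>
  For \<open>i \<noteq> j\<close> and \<open>c\<^sup>2 + |b|\<^sup>2 = 1\<close>, this is the element of \<open>SU(2)\<close> with first row \<open>(c, b)\<close>,
  acting on the coordinates \<open>i\<close> and \<open>j\<close>. A real diagonal \<open>c\<close> suffices, as the one-parameter
  groups generated by the off-diagonal skew-Hermitian matrices consist of such rotations.
\<close>

definition planar :: "'n \<Rightarrow> 'n \<Rightarrow> real \<Rightarrow> complex \<Rightarrow> complex^'n^'n" where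
  "planar i j c b = (\<chi> k l.
     if l = i then (if k = i then of_real c else if k = j then - cnj b else 0)
     else if l = j then (if k = i then b else if k = j then of_real c else 0)
     else (if k = l then 1 else 0))"

lemma planar_right:
  assumes "i \<noteq> j"
  shows "(X ** planar i j c b) $ k $ l =
    (if l = i then of_real c * X $ k $ i - cnj b * X $ k $ j
     else if l = j then b * X $ k $ i + of_real c * X $ k $ j
     else X $ k $ l)"
proof -
  have "(X ** planar i j c b) $ k $ l = (\<Sum>m\<in>UNIV. X $ k $ m * planar i j c b $ m $ l)"
    by (simp add: matrix_matrix_mult_def)
  also have "\<dots> = (\<Sum>m\<in>(if l = i \<or> l = j then {i, j} else {l}).
      X $ k $ m * planar i j c b $ m $ l)"
    by (rule sum.mono_neutral_right) (auto simp: planar_def)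
  finally show ?thesis
    using assms by (auto simp: planar_def)
qed

lemma planar_left:
  assumes "i \<noteq> j"
  shows "(adj (planar i j c b) ** X) $ k $ l =
    (if k = i then of_real c * X $ i $ l - b * X $ j $ l
     else if k = j then cnj b * X $ i $ l + of_real c * X $ j $ l
     else X $ k $ l)"
proof -
  have "(adj (planar i j c b) ** X) $ k $ l = adj (adj X ** planar i j c b) $ k $ l"
    by (simp add: adj_mult del: adj_nth)
  then show ?thesis
    by (simp add: planar_right [OF assms])
qed

lemma unitary_planar:
  assumes "i \<noteq> j" and "c\<^sup>2 + (cmod b)\<^sup>2 = 1"
  shows "unitary (planar i j c b)"
proof -
  have *: "of_real c * of_real c + b * cnj b = 1"
    using arg_cong [OF assms(2), of complex_of_real]
    by (simp add: power2_eq_square [of "complex_of_real c"] complex_norm_square del: of_real_power)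
       (simp add: complex_norm_square power2_eq_square)
  show ?thesis
    unfolding unitary_def vec_eq_iff planar_left [OF assms(1)]
    using assms(1) * by (auto simp: planar_def mat_def algebra_simps)
qed

section \<open>First-order conditions at a maximum of a weighted trace\<close>

text \<open>
  Maximizing this over unitary equivalence is the setting of von Neumann's trace inequality: for
  distinct positive weights, the maximum is attained only at diagonal matrices.
\<close>

definition wtrace :: "('n::finite \<Rightarrow> real) \<Rightarrow> complex^'n^'n \<Rightarrow> real" where
  "wtrace d M = (\<Sum>k\<in>UNIV. d k * Re (M $ k $ k))"

lemma wtrace_mono_planeD:
  assumes "i \<noteq> j" and "wtrace d M' \<le> wtrace d M"
    and "\<And>k. k \<noteq> i \<Longrightarrow> k \<noteq> j \<Longrightarrow> M' $ k $ k = M $ k $ k"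
  shows "d i * Re (M' $ i $ i) + d j * Re (M' $ j $ j)
    \<le> d i * Re (M $ i $ i) + d j * Re (M $ j $ j)"
proof -
  have split: "wtrace d N = d i * Re (N $ i $ i) + d j * Re (N $ j $ j)
      + (\<Sum>k\<in>UNIV - {i, j}. d k * Re (N $ k $ k))" for N
  proof -
    have "wtrace d N = (\<Sum>k\<in>{i, j}. d k * Re (N $ k $ k))
        + (\<Sum>k\<in>UNIV - {i, j}. d k * Re (N $ k $ k))"
      unfolding wtrace_def by (subst sum.subset_diff [of "{i, j}"]) auto
    then show ?thesis
      using assms(1) by simp
  qed
  have "(\<Sum>k\<in>UNIV - {i, j}. d k * Re (M' $ k $ k)) = (\<Sum>k\<in>UNIV - {i, j}. d k * Re (M $ k $ k))"
    by (rule sum.cong) (auto simp: assms(3))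
  with assms(2) show ?thesis
    by (simp add: split)
qed

lemma Re_of_real_mult: "Re (of_real a * z) = a * Re z"
  by simp

text \<open>
  A real-linear functional of \<open>z\<close> is dominated by a quadratic one near 0 only if it vanishes. This
  turns maximality under all rotations of a plane into a first-order equation.
\<close>

lemma zero_if_linear_le_quadratic:
  fixes w :: complex
  assumes "\<And>z. Re (z * w) \<le> (cmod z)\<^sup>2 * r"
  shows "w = 0"
proof (rule ccontr)
  assume "w \<noteq> 0"
  define N where "N = (cmod w)\<^sup>2"
  have N: "N > 0"
    using \<open>w \<noteq> 0\<close> by (simp add: N_def)
  have *: "t * N \<le> t\<^sup>2 * N * r" for t :: real
  proof -
    have "Re (of_real t * cnj w * w) = t * N"
      by (simp add: N_def cmod_power2 power2_eq_square [of "Re w"] power2_eq_square [of "Im w"]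
          algebra_simps)
    moreover have "(cmod (of_real t * cnj w))\<^sup>2 = t\<^sup>2 * N"
      by (simp add: N_def norm_mult power_mult_distrib)
    ultimately show ?thesis
      using assms [of "of_real t * cnj w"] by simp
  qed
  define t where "t = 1 / (1 + \<bar>r\<bar>)"
  have t: "t > 0" "t * r < 1"
    by (auto simp: t_def field_simps abs_if)
  have "t * N \<le> (t * N) * (t * r)"
    using * [of t] by (simp add: power2_eq_square algebra_simps)
  moreover have "(t * N) * (t * r) < (t * N) * 1"
    using t N by (intro mult_strict_left_mono) auto
  ultimately show False
    by simp
qed

text \<open>
  A rational parametrization of the admissible pairs \<open>(c, b)\<close>, given by the Cayley transform. With
  it, the gain in a functional linear in the rotation becomes, up to a positive factor, an exact
  difference of a linear and a quadratic term in \<open>z\<close>.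
\<close>

lemma cayley_circle:
  fixes z :: complex
  defines "r \<equiv> (cmod z)\<^sup>2"
  shows "((1 - r) / (1 + r))\<^sup>2 + (cmod (of_real (2 / (1 + r)) * z))\<^sup>2 = 1"
proof -
  have r: "1 + r > 0"
    by (simp add: r_def add_pos_nonneg)
  have "(cmod (of_real (2 / (1 + r)) * z))\<^sup>2 = (2 / (1 + r))\<^sup>2 * r"
    by (simp only: norm_mult power_mult_distrib r_def norm_of_real power2_abs)
  also have "((1 - r) / (1 + r))\<^sup>2 + \<dots> = ((1 - r)\<^sup>2 + 4 * r) / (1 + r)\<^sup>2"
    by (simp add: power_divide add_divide_distrib)
  also have "(1 - r)\<^sup>2 + 4 * r = (1 + r)\<^sup>2"
    by (simp add: power2_eq_square algebra_simps)
  finally show ?thesis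
    using r by simp
qed

text \<open>
  The equation says that the entries \<open>(i, j)\<close> and \<open>(j, i)\<close> of \<open>diag(d) M\<close> are conjugate to each
  other: the derivative of the weighted trace along skew-Hermitian directions of the plane vanishes.
\<close>

lemma right_maximal:
  assumes "i \<noteq> j"
    and max: "\<And>c b. c\<^sup>2 + (cmod b)\<^sup>2 = 1 \<Longrightarrow> wtrace d (M ** planar i j c b) \<le> wtrace d M"
  shows "of_real (d j) * M $ j $ i = of_real (d i) * cnj (M $ i $ j)"
proof -
  have "Re (z * (of_real (d j) * M $ j $ i - of_real (d i) * cnj (M $ i $ j)))
      \<le> (cmod z)\<^sup>2 * (d i * Re (M $ i $ i) + d j * Re (M $ j $ j))" for z
  proof -
    define r where "r = (cmod z)\<^sup>2"
    have r: "1 + r > 0"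
      by (simp add: r_def add_pos_nonneg)
    define k where "k = 2 / (1 + r)"
    have k: "k > 0" "(1 - r) / (1 + r) = 1 - k * r"
      using r by (simp_all add: k_def field_simps)
    have "wtrace d (M ** planar i j (1 - k * r) (of_real k * z)) \<le> wtrace d M"
      using max cayley_circle [of z] unfolding r_def [symmetric] k_def [symmetric] k by blast
    from wtrace_mono_planeD [OF assms(1) this]
    have "k * Re (z * (of_real (d j) * M $ j $ i - of_real (d i) * cnj (M $ i $ j)))
        \<le> k * (r * (d i * Re (M $ i $ i) + d j * Re (M $ j $ j)))"
      using assms(1) by (simp add: planar_right algebra_simps)
    then show ?thesis
      using k unfolding r_def by simp
  qed
  from zero_if_linear_le_quadratic [OF this] show ?thesis
    by simp
qed

lemma wtrace_adj [simp]: "wtrace d (adj M) = wtrace d M"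
  by (simp add: wtrace_def)

text \<open>
  Stationarity on both sides gives \<open>d\<^sub>j m\<^sub>j\<^sub>i = d\<^sub>i cnj m\<^sub>i\<^sub>j\<close> and \<open>d\<^sub>j cnj m\<^sub>i\<^sub>j = d\<^sub>i m\<^sub>j\<^sub>i\<close>, a
  linear system with determinant \<open>d\<^sub>j\<^sup>2 - d\<^sub>i\<^sup>2 \<noteq> 0\<close>.
\<close>

lemma two_sided_maximal:
  assumes "i \<noteq> j" and d: "0 < d i" "0 < d j" "d i \<noteq> d j"
    and R: "\<And>c b. c\<^sup>2 + (cmod b)\<^sup>2 = 1 \<Longrightarrow> wtrace d (M ** planar i j c b) \<le> wtrace d M"
    and L: "\<And>c b. c\<^sup>2 + (cmod b)\<^sup>2 = 1 \<Longrightarrow> wtrace d (adj (planar i j c b) ** M) \<le> wtrace d M"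
  shows "M $ i $ j = 0" "M $ j $ i = 0"
proof -
  have 1: "of_real (d j) * M $ j $ i = of_real (d i) * cnj (M $ i $ j)"
    using right_maximal [OF assms(1) R] .
  have "wtrace d (adj M ** planar i j c b) \<le> wtrace d (adj M)" if "c\<^sup>2 + (cmod b)\<^sup>2 = 1" for c b
    using L [OF that] by (metis adj_adj adj_mult wtrace_adj)
  from right_maximal [OF assms(1) this]
  have 2: "of_real (d j) * cnj (M $ i $ j) = of_real (d i) * M $ j $ i"
    by simp
  have "of_real (d j) * (of_real (d j) * M $ j $ i) = of_real (d i) * (of_real (d i) * M $ j $ i)"
    unfolding 1 by (metis 2 mult.left_commute)
  then have "of_real ((d j)\<^sup>2 - (d i)\<^sup>2) * M $ j $ i = 0"
    by (simp add: power2_eq_square algebra_simps)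
  moreover have "(d j)\<^sup>2 \<noteq> (d i)\<^sup>2"
    using d by simp
  ultimately show ji: "M $ j $ i = 0"
    by (metis eq_iff_diff_eq_0 mult_eq_0_iff of_real_eq_0_iff)
  from 1 show "M $ i $ j = 0"
    using d by (simp add: ji)
qed

text \<open>
  Conjugation acts separately on the Hermitian and the skew-Hermitian part of \<open>M\<close>, and the latter
  has an imaginary diagonal. So only the Hermitian part matters, and its off-diagonal entry has to vanish:
  this is the variational form of the spectral theorem.
\<close>

lemma conjugation_maximal:
  assumes "i \<noteq> j" and d: "d i \<noteq> d j"
    and max: "\<And>c b. c\<^sup>2 + (cmod b)\<^sup>2 = 1 \<Longrightarrow>
      wtrace d (adj (planar i j c b) ** (M ** planar i j c b)) \<le> wtrace d M"
  shows "M $ j $ i = - cnj (M $ i $ j)"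
proof -
  let ?w = "of_real (d j - d i) * (M $ j $ i + cnj (M $ i $ j))"
  have "Re (z * ?w) \<le> (cmod z)\<^sup>2 * ((d j - d i) * Re (M $ j $ j - M $ i $ i))" for z
  proof -
    define r where "r = (cmod z)\<^sup>2"
    \<comment> \<open>The gain is quadratic in the rotation, so only \<open>c\<^sup>2\<close>, \<open>c b\<close> and \<open>|b|\<^sup>2\<close> need to be rational.\<close>
    define c where "c = 1 / sqrt (1 + r)"
    define b where "b = of_real c * z"
    have r: "1 + r > 0"
      by (simp add: r_def add_pos_nonneg)
    have c: "c\<^sup>2 = 1 / (1 + r)" "c\<^sup>2 > 0"
      using r by (simp_all add: c_def power_divide)
    have cc: "c\<^sup>2 + c\<^sup>2 * r = 1"
      using r by (simp add: c field_simps)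
    let ?M' = "adj (planar i j c b) ** (M ** planar i j c b)"
    let ?q = "r * Re (M $ i $ i - M $ j $ j) + Re (z * (M $ j $ i + cnj (M $ i $ j)))"
    have "c\<^sup>2 + (cmod b)\<^sup>2 = 1"
      using cc by (simp add: b_def norm_mult power_mult_distrib r_def)
    from max [OF this] have "wtrace d ?M' \<le> wtrace d M" .
    from wtrace_mono_planeD [OF assms(1) this]
    have le: "d i * Re (?M' $ i $ i) + d j * Re (?M' $ j $ j)
        \<le> d i * Re (M $ i $ i) + d j * Re (M $ j $ j)"
      using assms(1) by (simp add: planar_left planar_right)
    have r2: "r = Re z * Re z + Im z * Im z"
      unfolding r_def cmod_power2 by (simp only: power2_eq_square)
    have "Re (?M' $ i $ i) = c\<^sup>2 * Re (M $ i $ i) + c\<^sup>2 * r * Re (M $ j $ j)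
        - c\<^sup>2 * Re (z * (M $ j $ i + cnj (M $ i $ j)))"
      using assms(1)
      by (simp add: planar_left planar_right b_def r2 power2_eq_square algebra_simps)
    moreover have "\<dots> = (c\<^sup>2 + c\<^sup>2 * r) * Re (M $ i $ i) - c\<^sup>2 * ?q"
      by (simp add: algebra_simps)
    ultimately have ii: "Re (?M' $ i $ i) = Re (M $ i $ i) - c\<^sup>2 * ?q"
      by (simp only: cc mult_1)
    have "Re (?M' $ j $ j) = c\<^sup>2 * Re (M $ j $ j) + c\<^sup>2 * r * Re (M $ i $ i)
        + c\<^sup>2 * Re (z * (M $ j $ i + cnj (M $ i $ j)))"
      using assms(1)
      by (simp add: planar_left planar_right b_def r2 power2_eq_square algebra_simps)
    moreover have "\<dots> = (c\<^sup>2 + c\<^sup>2 * r) * Re (M $ j $ j) + c\<^sup>2 * ?q"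
      by (simp add: algebra_simps)
    ultimately have jj: "Re (?M' $ j $ j) = Re (M $ j $ j) + c\<^sup>2 * ?q"
      by (simp only: cc mult_1)
    have "c\<^sup>2 * ((d j - d i) * ?q) \<le> c\<^sup>2 * 0"
      using le unfolding ii jj by (simp add: algebra_simps)
    then have "(d j - d i) * ?q \<le> 0"
      using c(2) by (simp only: mult_le_cancel_left_pos)
    moreover have "Re (z * ?w) = (d j - d i) * Re (z * (M $ j $ i + cnj (M $ i $ j)))"
      by (simp only: mult.left_commute [of z] Re_of_real_mult)
    ultimately show ?thesis
      unfolding r_def [symmetric] by (simp add: algebra_simps)
  qed
  from zero_if_linear_le_quadratic [OF this] show ?thesis
    using d by (simp add: eq_neg_iff_add_eq_0)
qed

section \<open>A singular value decomposition adapted to a perturbation\<close>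

lemma ex_separating_weights: "\<exists>d :: 'n::finite \<Rightarrow> real. (\<forall>k. 0 < d k) \<and> inj d"
proof -
  obtain f :: "'n \<Rightarrow> nat" where "inj f"
    using finite_imp_inj_to_nat_seg [of "UNIV :: 'n set"] by auto
  then have "inj (\<lambda>k. real (f k) + 1)"
    by (auto simp: inj_def)
  then show ?thesis
    by (intro exI [of _ "\<lambda>k. real (f k) + 1"]) auto
qed

text \<open>The closed set \<open>C\<close> is the constraint: all pairs, or those that diagonalize a given matrix.\<close>

lemma wtrace_attains_max:
  fixes A :: "complex^'n^'n"
  assumes "closed C" "(W0, V0) \<in> C" "unitary W0" "unitary V0"
  obtains W V where "unitary W" "unitary V" "(W, V) \<in> C"
    "\<And>W' V'. unitary W' \<Longrightarrow> unitary V' \<Longrightarrow> (W', V') \<in> C \<Longrightarrow>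
      wtrace d (adj W' ** A ** V') \<le> wtrace d (adj W ** A ** V)"
proof -
  let ?K = "({U. unitary U} \<times> {U. unitary U}) \<inter> C"
  have K: "compact ?K"
    using assms(1) by (intro compact_Int_closed compact_Times compact_unitary)
  have ne: "?K \<noteq> {}"
    using assms by blast
  have cont: "continuous_on ?K (\<lambda>p. wtrace d (adj (fst p) ** A ** snd p))"
    unfolding wtrace_def
    by (intro continuous_intros continuous_on_matrix_mult continuous_on_adj)
  obtain p where "p \<in> ?K"
    and max: "\<forall>q\<in>?K. wtrace d (adj (fst q) ** A ** snd q) \<le> wtrace d (adj (fst p) ** A ** snd p)"
    using continuous_attains_sup [OF K ne cont] by (rule bexE)
  show ?thesis
  proof (rule that [of "fst p" "snd p"])
    show "wtrace d (adj W' ** A ** V') \<le> wtrace d (adj (fst p) ** A ** snd p)"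
      if "unitary W'" "unitary V'" "(W', V') \<in> C" for W' V'
      using bspec [OF max, of "(W', V')"] that by simp
  qed (use \<open>p \<in> ?K\<close> in auto)
qed

text \<open>
  Rotating either frame of a maximizing pair cannot increase the weighted trace, so all off-diagonal
  entries vanish. The phases of the diagonal entries are then absorbed into \<open>V\<close>.
\<close>

lemma singular_value_decomposition:
  fixes A :: "complex^'n^'n"
  obtains W V and s :: "'n \<Rightarrow> real"
  where "unitary W" "unitary V" "\<And>k. 0 \<le> s k" "adj W ** A ** V = diag (\<lambda>k. of_real (s k))"
proof -
  obtain d :: "'n \<Rightarrow> real" where d: "\<And>k. 0 < d k" "inj d"
    using ex_separating_weights by blast
  obtain W V where WV: "unitary W" "unitary V"
    and max: "\<And>W' V'. unitary W' \<Longrightarrow> unitary V' \<Longrightarrow>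
      wtrace d (adj W' ** A ** V') \<le> wtrace d (adj W ** A ** V)"
    using wtrace_attains_max [of UNIV "mat 1" "mat 1" d A] unitary_mat_1 by auto
  define M where "M = adj W ** A ** V"
  have off: "M $ i $ j = 0" if "i \<noteq> j" for i j
  proof (rule two_sided_maximal(1) [OF that d(1) d(1)])
    show "d i \<noteq> d j"
      using d(2) that by (auto dest: injD)
    fix c :: real and b :: complex
    assume "c\<^sup>2 + (cmod b)\<^sup>2 = 1"
    then have P: "unitary (planar i j c b)"
      by (rule unitary_planar [OF that])
    show "wtrace d (M ** planar i j c b) \<le> wtrace d M"
      using max [OF WV(1) unitary_mult [OF WV(2) P]] by (simp add: M_def matrix_mul_assoc)
    show "wtrace d (adj (planar i j c b) ** M) \<le> wtrace d M"
      using max [OF unitary_mult [OF WV(1) P] WV(2)] by (simp add: M_def adj_mult matrix_mul_assoc)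
  qed
  \<comment> \<open>The diagonal matrix \<open>diag u\<close> rotates the diagonal entries of \<open>M\<close> to their absolute values.\<close>
  define u where "u k = (if M $ k $ k = 0 then 1 else cnj (sgn (M $ k $ k)))" for k
  have u: "cmod (u k) = 1" for k
    by (simp add: u_def norm_sgn)
  have Mu: "M $ k $ k * u k = of_real (cmod (M $ k $ k))" for k
  proof (cases "M $ k $ k = 0")
    case False
    have "M $ k $ k * cnj (sgn (M $ k $ k)) = (M $ k $ k * cnj (M $ k $ k)) / of_real (cmod (M $ k $ k))"
      by (simp add: sgn_div_norm scaleR_conv_of_real divide_inverse)
    also have "\<dots> = of_real (cmod (M $ k $ k))"
      using False by (simp add: complex_norm_square [symmetric] power2_eq_square)
    finally show ?thesis
      using False by (simp add: u_def)
  qed (simp add: u_def)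
  show ?thesis
  proof (rule that [OF WV(1) unitary_mult [OF WV(2) unitary_diag [of u]]])
    show "adj W ** A ** (V ** diag u) = diag (\<lambda>k. of_real (cmod (M $ k $ k)))"
      by (simp add: matrix_mul_assoc M_def [symmetric] vec_eq_iff diag_right off Mu)
  qed (simp_all add: u)
qed

text \<open>
  The two symmetries of a diagonal matrix on which the constrained maximization relies: equal entries
  allow simultaneous rotations of their plane, vanishing entries allow one-sided ones.
\<close>

lemma planar_commute_diag:
  assumes "i \<noteq> j" "s i = s j"
  shows "diag s ** planar i j c b = planar i j c b ** diag s"
proof -
  have "s k * planar i j c b $ k $ l = planar i j c b $ k $ l * s l" for k l
    using assms by (simp add: planar_def)
  then show ?thesis
    by (simp add: vec_eq_iff diag_left diag_right)
qed

lemma diag_planar_absorb: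
  assumes "s i = 0" "s j = 0"
  shows "diag s ** planar i j c b = diag s"
proof -
  have "s k * planar i j c b $ k $ l = diag s $ k $ l" for k l
    using assms by (simp add: planar_def)
  then show ?thesis
    by (simp add: vec_eq_iff diag_left)
qed

text \<open>
  Among the frames that diagonalize \<open>A\<close> with fixed singular values, those maximizing the weighted
  trace of \<open>E\<close> are adapted to \<open>E\<close>. This is degenerate perturbation theory: the last two
  conclusions concern the planes in which \<open>A\<close> does not determine the frames.
\<close>

lemma adapted_singular_value_decomposition:
  fixes A E :: "complex^'n^'n"
  obtains W V and s :: "'n \<Rightarrow> real"
  where "unitary W" "unitary V" "adj W ** A ** V = diag (\<lambda>k. of_real (s k))" "\<And>k. 0 \<le> s k"
    "\<And>i j. i \<noteq> j \<Longrightarrow> s i = s j \<Longrightarrow>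
      (adj W ** E ** V) $ j $ i = - cnj ((adj W ** E ** V) $ i $ j)"
    "\<And>i j. i \<noteq> j \<Longrightarrow> s i = 0 \<Longrightarrow> s j = 0 \<Longrightarrow> (adj W ** E ** V) $ i $ j = 0"
proof -
  obtain W0 V0 and s :: "'n \<Rightarrow> real"
    where 0: "unitary W0" "unitary V0" "\<And>k. 0 \<le> s k"
      "adj W0 ** A ** V0 = diag (\<lambda>k. of_real (s k))"
    using singular_value_decomposition [of A] by blast
  let ?S = "diag (\<lambda>k. of_real (s k)) :: complex^'n^'n"
  define C where "C = {p. adj (fst p) ** A ** snd p = ?S}"
  have "closed C"
    unfolding C_def
    by (intro closed_Collect_eq continuous_on_matrix_mult continuous_on_adj continuous_intros)
  obtain d :: "'n \<Rightarrow> real" where d: "\<And>k. 0 < d k" "inj d"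
    using ex_separating_weights by blast
  obtain W V where WV: "unitary W" "unitary V" "(W, V) \<in> C"
    and max: "\<And>W' V'. unitary W' \<Longrightarrow> unitary V' \<Longrightarrow> (W', V') \<in> C \<Longrightarrow>
      wtrace d (adj W' ** E ** V') \<le> wtrace d (adj W ** E ** V)"
    using wtrace_attains_max [OF \<open>closed C\<close>, of W0 V0 d E] 0 by (auto simp: C_def)
  have S: "adj W ** A ** V = ?S"
    using WV(3) by (simp add: C_def)
  define B where "B = adj W ** E ** V"
  have le: "wtrace d (adj X ** (B ** Y)) \<le> wtrace d B"
    if "unitary X" "unitary Y" "adj X ** (?S ** Y) = ?S" for X Y
  proof -
    have "adj (W ** X) ** A ** (V ** Y) = ?S"
      using that(3) by (simp add: adj_mult matrix_mul_assoc S [symmetric])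
    then show ?thesis
      using max [OF unitary_mult [OF WV(1) that(1)] unitary_mult [OF WV(2) that(2)]]
      by (simp add: C_def B_def adj_mult matrix_mul_assoc)
  qed
  have dne: "d i \<noteq> d j" if "i \<noteq> j" for i j
    using d(2) that by (auto dest: injD)
  have skew: "B $ j $ i = - cnj (B $ i $ j)" if "i \<noteq> j" "s i = s j" for i j
  proof (rule conjugation_maximal [OF that(1) dne [OF that(1)]])
    fix c :: real and b :: complex
    assume "c\<^sup>2 + (cmod b)\<^sup>2 = 1"
    then have P: "unitary (planar i j c b)"
      by (rule unitary_planar [OF that(1)])
    have "?S ** planar i j c b = planar i j c b ** ?S"
      using that by (simp add: planar_commute_diag)
    then have "adj (planar i j c b) ** (?S ** planar i j c b) = ?S"
      using P by (simp add: matrix_mul_assoc unitary_def)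
    then show "wtrace d (adj (planar i j c b) ** (B ** planar i j c b)) \<le> wtrace d B"
      by (rule le [OF P P])
  qed
  have zero: "B $ i $ j = 0" if "i \<noteq> j" "s i = 0" "s j = 0" for i j
  proof (rule two_sided_maximal(1) [OF that(1) d(1) d(1) dne [OF that(1)]])
    fix c :: real and b :: complex
    assume "c\<^sup>2 + (cmod b)\<^sup>2 = 1"
    then have P: "unitary (planar i j c b)"
      by (rule unitary_planar [OF that(1)])
    have R: "?S ** planar i j c b = ?S"
      using that by (simp add: diag_planar_absorb)
    have "adj (planar i j c b) ** ?S = adj (?S ** planar i j c b)"
      by (simp add: adj_mult)
    also have "\<dots> = ?S"
      by (simp add: R)
    finally have L: "adj (planar i j c b) ** ?S = ?S" .
    have 1: "adj (mat 1 :: complex^'n^'n) = mat 1"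
      by (simp add: vec_eq_iff mat_def)
    show "wtrace d (B ** planar i j c b) \<le> wtrace d B"
      using le [OF unitary_mat_1 P] by (simp add: R 1)
    show "wtrace d (adj (planar i j c b) ** B) \<le> wtrace d B"
      using le [OF P unitary_mat_1] by (simp add: L)
  qed
  show ?thesis
    by (rule that [OF WV(1,2) S 0(3) skew [unfolded B_def] zero [unfolded B_def]])
qed

text \<open>
  The equations for \<open>(i, j)\<close> and \<open>(j, i)\<close> are coupled by skewness. With \<open>p = P\<^sub>i\<^sub>j\<close>, \<open>q = Q\<^sub>i\<^sub>j\<close>
  they read \<open>\<sigma>\<^sub>j p - \<sigma>\<^sub>i q = b\<^sub>i\<^sub>j\<close> and \<open>\<sigma>\<^sub>i p - \<sigma>\<^sub>j q = - cnj b\<^sub>j\<^sub>i\<close>, with determinant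
  \<open>\<sigma>\<^sub>i\<^sup>2 - \<sigma>\<^sub>j\<^sup>2\<close>. Where the determinant is nonzero, Cramer's rule gives \<open>P\<close> and \<open>Q\<close>; where it is zero,
  the assumptions on \<open>B\<close> make both equations equivalent, and \<open>q = 0\<close> is a valid choice.
\<close>

lemma skew_hermitian_diagonalizing_correction:
  fixes B :: "complex^'n^'n" and s :: "'n \<Rightarrow> real"
  assumes nn: "\<And>k. 0 \<le> s k"
    and skew: "\<And>i j. i \<noteq> j \<Longrightarrow> s i = s j \<Longrightarrow> B $ j $ i = - cnj (B $ i $ j)"
    and zero: "\<And>i j. i \<noteq> j \<Longrightarrow> s i = 0 \<Longrightarrow> s j = 0 \<Longrightarrow> B $ i $ j = 0"
  obtains P Q where "adj P = - P" "adj Q = - Q"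
    "\<And>i j. i \<noteq> j \<Longrightarrow> B $ i $ j - P $ i $ j * of_real (s j) + of_real (s i) * Q $ i $ j = 0"
proof
  define D where "D i j = complex_of_real ((s i)\<^sup>2 - (s j)\<^sup>2)" for i j
  have D: "D i j \<noteq> 0" if "s i \<noteq> s j" for i j
    using that nn [of i] nn [of j] unfolding D_def of_real_eq_0_iff by simp
  have Dcnj: "cnj (D i j) = D i j" "D j i = - D i j" for i j
    by (simp_all add: D_def)
  \<comment> \<open>For \<open>s i = s j = 0\<close>, the quotient \<open>B $ i $ j / 0\<close> is 0, as it should be.\<close>
  define P :: "complex^'n^'n" where "P = (\<chi> i j. if i = j then 0
    else if s i = s j then B $ i $ j / of_real (s i)
    else - (of_real (s j) * B $ i $ j + of_real (s i) * cnj (B $ j $ i)) / D i j)"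
  define Q :: "complex^'n^'n" where "Q = (\<chi> i j. if s i = s j then 0
    else - (of_real (s i) * B $ i $ j + of_real (s j) * cnj (B $ j $ i)) / D i j)"
  have "cnj (P $ j $ i) = - P $ i $ j" for i j
    using skew [of i j] by (auto simp: P_def Dcnj(1) Dcnj(2) [of i j] add.commute)
  then show "adj P = - P"
    by (simp add: vec_eq_iff)
  have "cnj (Q $ j $ i) = - Q $ i $ j" for i j
    by (auto simp: Q_def Dcnj(1) Dcnj(2) [of i j] add.commute)
  then show "adj Q = - Q"
    by (simp add: vec_eq_iff)
  fix i j :: 'n
  assume ij: "i \<noteq> j"
  show "B $ i $ j - P $ i $ j * of_real (s j) + of_real (s i) * Q $ i $ j = 0"
  proof (cases "s i = s j")
    case True
    then show ?thesis
      using ij zero [OF ij] by (auto simp: P_def Q_def)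
  next
    case False
    then show ?thesis
      using ij D [OF False] unfolding P_def Q_def
      by (simp add: field_simps) (simp add: D_def power2_eq_square algebra_simps)
  qed
qed

section \<open>Dual complex matrices\<close>

definition dual_mat :: "complex^'n^'m \<Rightarrow> complex^'n^'m \<Rightarrow> dual_complex^'n^'m" where
  "dual_mat X Y = (\<chi> i j. Dual (X $ i $ j) (Y $ i $ j))"

lemma dual_mat_cases:
  obtains X Y where "A = dual_mat X Y"
proof
  show "A = dual_mat (\<chi> i j. std_part (A $ i $ j)) (\<chi> i j. dual_part (A $ i $ j))"
    by (simp add: dual_mat_def vec_eq_iff)
qed

lemma sum_Dual: "(\<Sum>k\<in>S. Dual (f k) (g k)) = Dual (sum f S) (sum g S)"
  by (induction S rule: infinite_finite_induct)
    (simp_all add: zero_dual_complex_def plus_dual_complex_def)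

lemma dual_mat_mult: "dual_mat X Y ** dual_mat X' Y' = dual_mat (X ** X') (X ** Y' + Y ** X')"
  by (simp add: dual_mat_def matrix_matrix_mult_def vec_eq_iff times_dual_complex_def sum_Dual
      sum.distrib)

lemma conj_transpose_dual_mat: "conj_transpose (dual_mat X Y) = dual_mat (adj X) (adj Y)"
  by (simp add: dual_mat_def conj_transpose_def dual_cnj_def vec_eq_iff)

lemma mat_1_dual_mat: "mat 1 = dual_mat (mat 1) 0"
  by (simp add: dual_mat_def mat_def vec_eq_iff one_dual_complex_def zero_dual_complex_def)

lemma conj_transpose_mult: "conj_transpose (X ** Y) = conj_transpose Y ** conj_transpose X"
proof -
  obtain A B C D where "X = dual_mat A B" "Y = dual_mat C D"
    using dual_mat_cases by metis
  then show ?thesis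
    by (simp add: dual_mat_mult conj_transpose_dual_mat adj_mult adj_add add.commute)
qed

lemma conj_transpose_conj_transpose [simp]: "conj_transpose (conj_transpose X) = X"
  by (simp add: conj_transpose_def dual_cnj_def vec_eq_iff)

lemma conj_transpose_transpose: "conj_transpose (transpose X) = transpose (conj_transpose X)"
  by (simp add: conj_transpose_def transpose_def vec_eq_iff)

lemma conj_transpose_uminus: "conj_transpose (- X) = - conj_transpose X"
  by (simp add: conj_transpose_def dual_cnj_def vec_eq_iff uminus_dual_complex_def)

lemma dual_unitary_mult:
  assumes "dual_unitary U" "dual_unitary V"
  shows "dual_unitary (U ** V)"
proof -
  have "conj_transpose (U ** V) ** (U ** V) = conj_transpose V ** (conj_transpose U ** U) ** V"
    "(U ** V) ** conj_transpose (U ** V) = U ** (V ** conj_transpose V) ** conj_transpose U"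
    by (simp_all add: conj_transpose_mult matrix_mul_assoc)
  then show ?thesis
    using assms by (simp add: dual_unitary_def)
qed

lemma dual_unitary_conj_transpose: "dual_unitary U \<Longrightarrow> dual_unitary (conj_transpose U)"
  by (simp add: dual_unitary_def)

lemma dual_unitary_transpose: "dual_unitary U \<Longrightarrow> dual_unitary (transpose U)"
  unfolding dual_unitary_def conj_transpose_transpose
  by (simp flip: matrix_transpose_mul)

lemma matrix_mult_uminus:
  fixes X :: "'a::ring_1^'n^'m" and Y :: "'a^'k^'n"
  shows "X ** (- Y) = - (X ** Y)" "(- X) ** Y = - (X ** Y)"
  by (simp_all add: matrix_matrix_mult_def vec_eq_iff sum_negf)

lemma dual_unitary_uminus: "dual_unitary U \<Longrightarrow> dual_unitary (- U)"
  by (simp add: dual_unitary_def conj_transpose_uminus matrix_mult_uminus)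

text \<open>
  \<open>W (I + P \<epsilon>)\<close> is unitary because \<open>(I + P \<epsilon>)\<^sup>* (I + P \<epsilon>) = I + (P\<^sup>* + P) \<epsilon>\<close>: the dual parts of
  unitary matrices are the tangent vectors of the unitary group.
\<close>

lemma dual_unitary_tangent:
  assumes "unitary W" and "adj P = - P"
  shows "dual_unitary (dual_mat W (W ** P))"
proof -
  have "adj W ** W = mat 1" "W ** adj W = mat 1"
    using assms(1) by (simp_all add: unitary_def unitary_right)
  moreover have "adj W ** (W ** P) = (adj W ** W) ** P"
    by (simp add: matrix_mul_assoc)
  ultimately show ?thesis
    using assms(2)
    by (simp add: dual_unitary_def conj_transpose_dual_mat dual_mat_mult adj_mult mat_1_dual_mat
        matrix_mult_uminus matrix_mul_assoc [symmetric])
qed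

text \<open>
  The matrix obtained below is in fact diagonal, with the singular values of the standard part of
  \<open>A\<close> as its standard part; symmetry is the property that the polar decomposition needs.
\<close>

lemma dual_singular_value_decomposition:
  fixes A :: "dual_complex^'n^'n"
  obtains W V where "dual_unitary W" "dual_unitary V" "dual_symmetric (conj_transpose W ** A ** V)"
proof -
  obtain X E where A: "A = dual_mat X E"
    by (rule dual_mat_cases)
  obtain W V and s :: "'n \<Rightarrow> real"
    where WV: "unitary W" "unitary V"
      and S: "adj W ** X ** V = diag (\<lambda>k. of_real (s k))"
      and B: "\<And>k. 0 \<le> s k"
        "\<And>i j. i \<noteq> j \<Longrightarrow> s i = s j \<Longrightarrow>
          (adj W ** E ** V) $ j $ i = - cnj ((adj W ** E ** V) $ i $ j)"
        "\<And>i j. i \<noteq> j \<Longrightarrow> s i = 0 \<Longrightarrow> s j = 0 \<Longrightarrow> (adj W ** E ** V) $ i $ j = 0"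
    by (rule adapted_singular_value_decomposition [of X E]) blast
  obtain P Q where PQ: "adj P = - P" "adj Q = - Q"
    and off: "\<And>i j. i \<noteq> j \<Longrightarrow> (adj W ** E ** V) $ i $ j - P $ i $ j * of_real (s j)
      + of_real (s i) * Q $ i $ j = 0"
    using skew_hermitian_diagonalizing_correction [of s "adj W ** E ** V"] B by blast
  define M where "M = adj W ** E ** V + - (P ** (adj W ** X ** V)) + (adj W ** X ** V) ** Q"
  have M: "M $ i $ j = 0" if "i \<noteq> j" for i j
    using off [OF that] by (simp add: M_def S diag_left diag_right)
  have "conj_transpose (dual_mat W (W ** P)) ** A ** dual_mat V (V ** Q)
      = dual_mat (diag (\<lambda>k. of_real (s k))) M"
    by (simp add: A conj_transpose_dual_mat dual_mat_mult adj_mult PQ S [symmetric] M_def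
        matrix_mult_uminus matrix_mul_assoc matrix_diff_rdistrib add_ac)
  moreover have "dual_symmetric (dual_mat (diag (\<lambda>k. of_real (s k))) M)"
    by (simp add: dual_symmetric_def dual_mat_def transpose_def vec_eq_iff) (metis M)
  ultimately show ?thesis
    using that [OF dual_unitary_tangent [OF WV(1) PQ(1)] dual_unitary_tangent [OF WV(2) PQ(2)]]
    by simp
qed

section \<open>Symmetric unitary polar decompositions\<close>

text \<open>
  Inserting \<open>W\<^sup>T W\<^sup>T\<^sup>* = I\<close> into \<open>A = W D V\<^sup>*\<close> turns the outer factor \<open>W\<close> into a congruence
  \<open>W D W\<^sup>T\<close>, which preserves symmetry.
\<close>

lemma left_DSUPD_exists: "\<exists>S U. left_DSUPD A S U"
proof -
  obtain W V where WV: "dual_unitary W" "dual_unitary V"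
    and sym: "dual_symmetric (conj_transpose W ** A ** V)" (is "dual_symmetric ?D")
    by (rule dual_singular_value_decomposition)
  let ?S = "W ** ?D ** transpose W"
  let ?U = "transpose (conj_transpose W) ** conj_transpose V"
  have cancel: "transpose W ** transpose (conj_transpose W) = mat 1"
    using WV(1) by (simp add: dual_unitary_def flip: matrix_transpose_mul)
  have "?S ** ?U = W ** ?D ** (transpose W ** transpose (conj_transpose W)) ** conj_transpose V"
    by (simp only: matrix_mul_assoc)
  also have "\<dots> = W ** ?D ** conj_transpose V"
    by (simp only: cancel matrix_mul_rid)
  also have "\<dots> = (W ** conj_transpose W) ** A ** (V ** conj_transpose V)"
    by (simp add: matrix_mul_assoc)
  also have "\<dots> = A"
    using WV by (simp add: dual_unitary_def)
  finally have "A = ?S ** ?U"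
    by simp
  moreover have "dual_symmetric ?S"
    using sym by (simp add: dual_symmetric_def matrix_transpose_mul matrix_mul_assoc)
  moreover have "dual_unitary ?U"
    using WV by (intro dual_unitary_mult dual_unitary_transpose dual_unitary_conj_transpose)
  ultimately show ?thesis
    unfolding left_DSUPD_def by blast
qed

lemma right_DSUPD_iff_left:
  "right_DSUPD A V R \<longleftrightarrow> left_DSUPD (transpose A) R (transpose V)"
proof -
  have "dual_unitary (transpose V) \<longleftrightarrow> dual_unitary V"
    using dual_unitary_transpose transpose_transpose by metis
  moreover have "A = V ** R \<longleftrightarrow> transpose A = R ** transpose V" if "transpose R = R"
    using that by (metis matrix_transpose_mul transpose_transpose)
  ultimately show ?thesis
    unfolding right_DSUPD_def left_DSUPD_def dual_symmetric_def by blast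
qed

lemma left_DSUPD_uminus:
  assumes "left_DSUPD A S U"
  shows "left_DSUPD A (- S) (- U)"
proof -
  have "transpose (- S) = - transpose S"
    by (simp add: transpose_def vec_eq_iff)
  then show ?thesis
    using assms
    by (simp add: left_DSUPD_def dual_symmetric_def dual_unitary_uminus matrix_mult_uminus)
qed

text \<open>
  As 2 is invertible in the dual complex numbers, equality would force \<open>U = 0\<close>, hence \<open>I = 0\<close>; but
  the index type of a matrix is nonempty.
\<close>

lemma dual_unitary_neq_uminus:
  assumes "dual_unitary U"
  shows "- U \<noteq> U"
proof
  assume "- U = U"
  then have "- (U $ i $ j) = U $ i $ j" for i j
    by (metis vector_uminus_component)
  moreover have "x = 0" if "- x = x" for x :: dual_complex
    using that by (cases x) (simp add: uminus_dual_complex_def zero_dual_complex_def)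
  ultimately have "U $ i $ j = 0" for i j
    by blast
  then have "U = 0"
    by (simp add: vec_eq_iff)
  then have "(mat 1 :: dual_complex^'a^'a) = 0"
    using assms by (simp add: dual_unitary_def)
  then have "(1 :: dual_complex) = 0"
    by (auto simp: vec_eq_iff mat_def split: if_splits)
  then show False
    by simp
qed

lemma left_DSUPD_not_unique:
  "\<exists>S U S' U'. left_DSUPD A S U \<and> left_DSUPD A S' U' \<and> U \<noteq> U'"
proof -
  obtain S U where "left_DSUPD A S U"
    using left_DSUPD_exists by blast
  moreover from this have "left_DSUPD A (- S) (- U)"
    by (rule left_DSUPD_uminus)
  moreover have "U \<noteq> - U"
    using calculation(1) dual_unitary_neq_uminus by (metis left_DSUPD_def)
  ultimately show ?thesis
    by blast
qed

lemma right_DSUPD_not_unique: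
  "\<exists>V R V' R'. right_DSUPD A V R \<and> right_DSUPD A V' R' \<and> V \<noteq> V'"
proof -
  obtain R U R' U' where "left_DSUPD (transpose A) R U" "left_DSUPD (transpose A) R' U'" "U \<noteq> U'"
    using left_DSUPD_not_unique by blast
  then have "right_DSUPD A (transpose U) R" "right_DSUPD A (transpose U') R'"
    "transpose U \<noteq> transpose U'"
    by (auto simp: right_DSUPD_iff_left dest: arg_cong [of _ _ transpose])
  then show ?thesis
    by blast
qed

theorem theorem4p1:
  fixes A :: "dual_complex^'n^'n"
  shows "(\<exists>U S. dual_unitary U \<and> dual_symmetric S \<and> A = S ** U)
    \<and> (\<exists>S U. left_DSUPD A S U)
    \<and> (\<exists>V R. right_DSUPD A V R)
    \<and> (\<exists>S U S' U'. left_DSUPD A S U \<and> left_DSUPD A S' U' \<and> (S, U) \<noteq> (S', U'))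
    \<and> (\<exists>V R V' R'. right_DSUPD A V R \<and> right_DSUPD A V' R' \<and> (V, R) \<noteq> (V', R'))"
  using left_DSUPD_not_unique [of A] right_DSUPD_not_unique [of A]
  unfolding left_DSUPD_def by blast

end
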